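(* Let $\mathcal{O}\subseteq\mathbb{R}^d$ be a possibly unbounded open subset and let $\varphi\in C^2(\mathcal{O})$ obey $0<\varphi\le 1$ on $\mathcal{O}$. Let $Av=-\operatorname{tr}(aD^2v)-\langle b,Dv\rangle+cv$ and $$Bv:=-[A,\varphi](\varphi^{-1}v),\quad\forall\,v\in C^2(\mathcal{O}).$$ Let $\Sigma\subseteq\partial\mathcal{O}$ be relatively open and let $\mathfrak{K}\subset C^2(\mathcal{O})$ (respectively, $\mathfrak{K}\subset W^{2,d}_{\mathrm{loc}}(\mathcal{O})$) be a convex cone. Suppose that the differential operator $\widehat A:=A+B$ has the weak maximum principle property on $\mathcal{O}\cup\Sigma$ for functions $u\in\mathfrak{K}$ which are bounded above, $\sup_{\mathcal{O}}u<\infty$. Then $A$ has the weak maximum principle property on $\mathcal{O}\cup\Sigma$ for functions $u\in\mathfrak{K}$ which obey the growth condition $$u\le C(1+\varphi^{-1})\quad\text{on }\mathcal{O}$$ for some constant $C$.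
   Context: $a:\mathcal{O}\to\mathscr{S}^+(d)$ takes values in the non-negative definite symmetric real $d\times d$ matrices, $b:\mathcal{O}\to\mathbb{R}^d$, $c:\mathcal{O}\to\mathbb{R}$; coefficients are everywhere-defined when $\mathfrak{K}\subset C^2(\mathcal{O})$ and measurable when $\mathfrak{K}\subset W^{2,d}_{\mathrm{loc}}(\mathcal{O})$. $[A,\varphi]v:=A(\varphi v)-\varphi Av$; thus $B$ is a first-order operator, given by the same formula on $W^{2,d}_{\mathrm{loc}}(\mathcal{O})$. Weak maximum principle property: an operator $L$ obeys the weak maximum principle property on $\mathcal{O}\cup\Sigma$ for a class of functions $\mathfrak{K}'$ if whenever $u\in\mathfrak{K}'$ obeys $Lu\le 0$ (a.e.) on $\mathcal{O}$ and $u^*\le 0$ on $\partial\mathcal{O}\setminus\bar\Sigma$, then $u\le 0$ on $\mathcal{O}$. Here $u^*$ is the upper semicontinuous envelope of $u$ on $\bar{\mathcal{O}}$.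
   Formalization: Added hypothesis: φu ∈ 𝔎 for every u ∈ 𝔎 obeying u ≤ C(1+φ⁻¹) for some C. Without it the claim fails: 𝒪=(0,1), φ=x, a=b=c=0, Σ=∂𝒪, 𝔎={t/x : t>0}, where u=1/x violates the conclusion. *)

theory Defs
  imports "HOL-Analysis.Analysis"
begin

text \<open>
  Functions on an open set \<open>U\<close> are represented by members of \<open>extensional U\<close>, so that a set of such
  representatives is exactly a set of functions \<open>U \<rightarrow> \<real>\<close>.
\<close>

definition partial_deriv :: "'n::finite \<Rightarrow> (real^'n \<Rightarrow> real) \<Rightarrow> real^'n \<Rightarrow> real" where
  "partial_deriv i f x = frechet_derivative f (at x) (axis i 1)"

primrec Ck_on :: "nat \<Rightarrow> (real^'n::finite) set \<Rightarrow> (real^'n \<Rightarrow> real) \<Rightarrow> bool" where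
  "Ck_on 0 U f \<longleftrightarrow> continuous_on U f"
| "Ck_on (Suc k) U f \<longleftrightarrow> f differentiable_on U \<and> (\<forall>i. Ck_on k U (partial_deriv i f))"

definition C2 :: "(real^'n::finite) set \<Rightarrow> (real^'n \<Rightarrow> real) set" where
  "C2 U = {f \<in> extensional U. Ck_on 2 U f}"

definition grad :: "(real^'n::finite \<Rightarrow> real) \<Rightarrow> real^'n \<Rightarrow> real^'n" where
  "grad f x = (\<chi> i. partial_deriv i f x)"

definition hess :: "(real^'n::finite \<Rightarrow> real) \<Rightarrow> real^'n \<Rightarrow> real^'n^'n" where
  "hess f x = (\<chi> i j. partial_deriv i (partial_deriv j f) x)"

definition test_fun :: "nat \<Rightarrow> (real^'n::finite) set \<Rightarrow> (real^'n \<Rightarrow> real) set" where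
  "test_fun k U = {\<psi>. Ck_on k UNIV \<psi> \<and> (\<exists>S\<subseteq>U. compact S \<and> (\<forall>x. x \<notin> S \<longrightarrow> \<psi> x = 0))}"

definition Lp_loc :: "nat \<Rightarrow> (real^'n::finite) set \<Rightarrow> (real^'n \<Rightarrow> 'b::euclidean_space) \<Rightarrow> bool" where
  "Lp_loc p U g \<longleftrightarrow> g \<in> borel_measurable (lebesgue_on U) \<and>
     (\<forall>S\<subseteq>U. compact S \<longrightarrow> integrable (lebesgue_on S) (\<lambda>x. norm (g x) ^ p))"

text \<open>
  Weak derivatives are required to be locally integrable, so that the integrals below exist.
  As in Gilbarg and Trudinger, derivatives of order \<open>k\<close> are tested against compactly supported
  \<open>C\<^sup>k\<close> functions; smooth test functions give the same derivatives.
\<close>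

definition is_weak_grad ::
    "(real^'n::finite) set \<Rightarrow> (real^'n \<Rightarrow> real) \<Rightarrow> (real^'n \<Rightarrow> real^'n) \<Rightarrow> bool" where
  "is_weak_grad U f g \<longleftrightarrow> Lp_loc 1 U g \<and>
     (\<forall>i. \<forall>\<psi>\<in>test_fun 1 U.
        (LINT x|lebesgue_on U. f x * partial_deriv i \<psi> x) = - (LINT x|lebesgue_on U. g x $ i * \<psi> x))"

definition is_weak_hess ::
    "(real^'n::finite) set \<Rightarrow> (real^'n \<Rightarrow> real) \<Rightarrow> (real^'n \<Rightarrow> real^'n^'n) \<Rightarrow> bool" where
  "is_weak_hess U f h \<longleftrightarrow> Lp_loc 1 U h \<and>
     (\<forall>i j. \<forall>\<psi>\<in>test_fun 2 U.
        (LINT x|lebesgue_on U. f x * partial_deriv i (partial_deriv j \<psi>) x)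
          = (LINT x|lebesgue_on U. h x $ i $ j * \<psi> x))"

text \<open>
  Weak derivatives are determined only up to a null set; the operators below are used only in
  statements that hold almost everywhere.
\<close>

definition weak_grad :: "(real^'n::finite) set \<Rightarrow> (real^'n \<Rightarrow> real) \<Rightarrow> real^'n \<Rightarrow> real^'n" where
  "weak_grad U f = (SOME g. is_weak_grad U f g)"

definition weak_hess :: "(real^'n::finite) set \<Rightarrow> (real^'n \<Rightarrow> real) \<Rightarrow> real^'n \<Rightarrow> real^'n^'n" where
  "weak_hess U f = (SOME h. is_weak_hess U f h)"

text \<open>
  This is \<open>W\<^bsup>2,d\<^esup>\<^bsub>loc\<^esub>(U)\<close> with \<open>d = CARD('n)\<close>.  By the Sobolev embedding every class in it has exactly one
  continuous representative on \<open>U\<close>, and the class is represented by that function.  Pointwise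
  statements about \<open>u\<close>, and its upper semicontinuous envelope, refer to this representative.
\<close>

definition W2d_loc :: "(real^'n::finite) set \<Rightarrow> (real^'n \<Rightarrow> real) set" where
  "W2d_loc U = {f \<in> extensional U. continuous_on U f \<and>
     (\<exists>g. is_weak_grad U f g \<and> Lp_loc CARD('n) U g) \<and>
     (\<exists>h. is_weak_hess U f h \<and> Lp_loc CARD('n) U h)}"

definition nonneg_symmetric :: "real^'n^'n::finite \<Rightarrow> bool" where
  "nonneg_symmetric M \<longleftrightarrow> transpose M = M \<and> (\<forall>\<xi>. 0 \<le> \<xi> \<bullet> (M *v \<xi>))"

definition A_classical ::
    "(real^'n \<Rightarrow> real^'n^'n) \<Rightarrow> (real^'n \<Rightarrow> real^'n) \<Rightarrow> (real^'n \<Rightarrow> real)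
      \<Rightarrow> (real^'n::finite \<Rightarrow> real) \<Rightarrow> real^'n \<Rightarrow> real" where
  "A_classical a b c v x = - trace (a x ** hess v x) - b x \<bullet> grad v x + c x * v x"

definition A_weak ::
    "(real^'n) set \<Rightarrow> (real^'n \<Rightarrow> real^'n^'n) \<Rightarrow> (real^'n \<Rightarrow> real^'n) \<Rightarrow> (real^'n \<Rightarrow> real)
      \<Rightarrow> (real^'n::finite \<Rightarrow> real) \<Rightarrow> real^'n \<Rightarrow> real" where
  "A_weak U a b c v x = - trace (a x ** weak_hess U v x) - b x \<bullet> weak_grad U v x + c x * v x"

definition commutator ::
    "(('x \<Rightarrow> real) \<Rightarrow> 'x \<Rightarrow> real) \<Rightarrow> ('x \<Rightarrow> real) \<Rightarrow> ('x \<Rightarrow> real) \<Rightarrow> 'x \<Rightarrow> real" where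
  "commutator L \<phi> v x = L (\<lambda>y. \<phi> y * v y) x - \<phi> x * L v x"

definition B_op ::
    "(('x \<Rightarrow> real) \<Rightarrow> 'x \<Rightarrow> real) \<Rightarrow> ('x \<Rightarrow> real) \<Rightarrow> ('x \<Rightarrow> real) \<Rightarrow> 'x \<Rightarrow> real" where
  "B_op L \<phi> v x = - commutator L \<phi> (\<lambda>y. inverse (\<phi> y) * v y) x"

definition A_hat ::
    "(('x \<Rightarrow> real) \<Rightarrow> 'x \<Rightarrow> real) \<Rightarrow> ('x \<Rightarrow> real) \<Rightarrow> ('x \<Rightarrow> real) \<Rightarrow> 'x \<Rightarrow> real" where
  "A_hat L \<phi> v x = L v x + B_op L \<phi> v x"

definition convex_cone_on :: "'x set \<Rightarrow> ('x \<Rightarrow> real) set \<Rightarrow> bool" where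
  "convex_cone_on U K \<longleftrightarrow>
     (\<forall>u\<in>K. \<forall>v\<in>K. \<forall>s>0. \<forall>t>0. (\<lambda>x\<in>U. s * u x + t * v x) \<in> K)"

text \<open>The envelope is meant at points \<open>x\<close> of \<open>closure U\<close>, and takes extended real values.\<close>

definition usc_envelope :: "('x::metric_space) set \<Rightarrow> ('x \<Rightarrow> real) \<Rightarrow> 'x \<Rightarrow> ereal" where
  "usc_envelope U u x = (INF r\<in>{0<..}. SUP y\<in>ball x r \<inter> U. ereal (u y))"

definition wmp_classical ::
    "(real^'n::finite) set \<Rightarrow> (real^'n) set \<Rightarrow> ((real^'n \<Rightarrow> real) \<Rightarrow> real^'n \<Rightarrow> real)
      \<Rightarrow> (real^'n \<Rightarrow> real) set \<Rightarrow> bool" where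
  "wmp_classical U \<Sigma> L K \<longleftrightarrow>
     (\<forall>u\<in>K. (\<forall>x\<in>U. L u x \<le> 0) \<longrightarrow> (\<forall>x\<in>frontier U - closure \<Sigma>. usc_envelope U u x \<le> 0)
        \<longrightarrow> (\<forall>x\<in>U. u x \<le> 0))"

definition wmp_weak ::
    "(real^'n::finite) set \<Rightarrow> (real^'n) set \<Rightarrow> ((real^'n \<Rightarrow> real) \<Rightarrow> real^'n \<Rightarrow> real)
      \<Rightarrow> (real^'n \<Rightarrow> real) set \<Rightarrow> bool" where
  "wmp_weak U \<Sigma> L K \<longleftrightarrow>
     (\<forall>u\<in>K. (AE x in lebesgue_on U. L u x \<le> 0) \<longrightarrow> (\<forall>x\<in>frontier U - closure \<Sigma>. usc_envelope U u x \<le> 0)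
        \<longrightarrow> (\<forall>x\<in>U. u x \<le> 0))"

definition phi_growth :: "'x set \<Rightarrow> ('x \<Rightarrow> real) \<Rightarrow> ('x \<Rightarrow> real) \<Rightarrow> bool" where
  "phi_growth U \<phi> u \<longleftrightarrow> (\<exists>C. \<forall>x\<in>U. u x \<le> C * (1 + inverse (\<phi> x)))"

end

theory Submission
  imports Defs
begin

text \<open>
  Put \<open>v = \<phi> u\<close>, which lies in \<open>K\<close> by the assumed stability of \<open>K\<close> under multiplication by \<open>\<phi>\<close>.
  Expanding the commutator,
  \<open>(A + B) v = A v - A (\<phi> \<phi>\<^sup>-\<^sup>1 v) + \<phi> A (\<phi>\<^sup>-\<^sup>1 v) = \<phi> A u\<close>,
  so \<open>A u\<close> and \<open>(A + B) v\<close> have the same sign (\<open>A_hat_times_phi\<close>).  Since \<open>0 < \<phi> \<le> 1\<close>, the growth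
  condition on \<open>u\<close> makes \<open>v\<close> bounded above: \<open>v \<le> C (\<phi> + 1) \<le> 2 \<bar>C\<bar>\<close> (\<open>bdd_above_times_phi\<close>), and
  multiplication by \<open>\<phi>\<close> preserves the sign of \<open>u\<close> while not enlarging its positive part, so the
  boundary condition passes from \<open>u\<close> to \<open>v\<close> (\<open>usc_envelope_times_phi_nonpos\<close>).  The weak maximum
  principle for \<open>A + B\<close>, applied to \<open>v\<close>, then gives \<open>v \<le> 0\<close>, that is, \<open>u \<le> 0\<close>.

  The computation of \<open>(A + B) v\<close> replaces \<open>\<phi> \<phi>\<^sup>-\<^sup>1 v\<close> by \<open>v\<close> and \<open>\<phi>\<^sup>-\<^sup>1 v\<close> by \<open>u\<close>.  These functions agree
  only on \<open>U\<close>, so it needs that the values of \<open>A f\<close> on \<open>U\<close> depend only on the values of \<open>f\<close> on \<open>U\<close>.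
  The classical operator on an open set and the weak operator both have this property.
\<close>

definition local_on :: "'x set \<Rightarrow> (('x \<Rightarrow> real) \<Rightarrow> 'x \<Rightarrow> real) \<Rightarrow> bool" where
  "local_on U L \<longleftrightarrow> (\<forall>f g. (\<forall>x\<in>U. f x = g x) \<longrightarrow> (\<forall>x\<in>U. L f x = L g x))"

lemma local_onD:
  assumes "local_on U L" "\<And>y. y \<in> U \<Longrightarrow> f y = g y" "x \<in> U"
  shows "L f x = L g x"
  using assms unfolding local_on_def by blast

text \<open>
  Two functions that agree near \<open>x\<close> have the same derivatives at \<open>x\<close>,
  hence the choice in \<^const>\<open>frechet_derivative\<close> is made from the same (possibly empty) set.
\<close>

lemma partial_deriv_cong_open:
  assumes "open U" "x \<in> U" "\<And>y. y \<in> U \<Longrightarrow> f y = g y"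
  shows "partial_deriv i f x = partial_deriv i g x"
proof -
  have "(f has_derivative D) (at x) \<longleftrightarrow> (g has_derivative D) (at x)" for D
    using assms by (metis has_derivative_transform_within_open)
  then show ?thesis
    unfolding partial_deriv_def frechet_derivative_def by simp
qed

lemma local_on_A_classical:
  fixes U :: "(real^'n::finite) set"
  assumes "open U"
  shows "local_on U (A_classical a b c)"
  unfolding local_on_def
proof (intro allI impI ballI)
  fix f g :: "real^'n \<Rightarrow> real" and x
  assume eq: "\<forall>x\<in>U. f x = g x" and "x \<in> U"
  have first: "partial_deriv i f y = partial_deriv i g y" if "y \<in> U" for i y
    using partial_deriv_cong_open[OF assms that] eq by blast
  have "partial_deriv i (partial_deriv j f) x = partial_deriv i (partial_deriv j g) x" for i j
    using partial_deriv_cong_open[OF assms \<open>x \<in> U\<close>] first by blast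
  with first \<open>x \<in> U\<close> eq show "A_classical a b c f x = A_classical a b c g x"
    by (simp add: A_classical_def hess_def grad_def)
qed

lemma integral_lebesgue_on_cong:
  fixes f g :: "real^'n \<Rightarrow> real"
  assumes "\<And>x. x \<in> U \<Longrightarrow> f x = g x"
  shows "(LINT x|lebesgue_on U. f x * k x) = (LINT x|lebesgue_on U. g x * k x)"
  by (rule Bochner_Integration.integral_cong) (auto simp: assms)

text \<open>
  The function enters the defining conditions of its weak derivatives only through integrals over
  \<open>U\<close>, so both functions have the same weak derivatives, and the choices made in \<^const>\<open>weak_grad\<close>
  and \<^const>\<open>weak_hess\<close> coincide everywhere, not just up to a null set.
\<close>

lemma local_on_A_weak:
  fixes U :: "(real^'n::finite) set"
  shows "local_on U (A_weak U a b c)"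
  unfolding local_on_def
proof (intro allI impI ballI)
  fix f g :: "real^'n \<Rightarrow> real" and x
  assume eq: "\<forall>x\<in>U. f x = g x" and "x \<in> U"
  note int_eq = integral_lebesgue_on_cong[of U f g, OF eq[rule_format]]
  have "weak_grad U f = weak_grad U g" "weak_hess U f = weak_hess U g"
    by (simp_all add: weak_grad_def is_weak_grad_def weak_hess_def is_weak_hess_def int_eq)
  with eq \<open>x \<in> U\<close> show "A_weak U a b c f x = A_weak U a b c g x"
    by (simp add: A_weak_def)
qed

lemma A_hat_times_phi:
  assumes "local_on U L" and "\<forall>x\<in>U. \<phi> x \<noteq> 0" and "x \<in> U"
  shows "A_hat L \<phi> (\<lambda>x\<in>U. \<phi> x * u x) x = \<phi> x * L u x"
proof -
  let ?v = "\<lambda>x\<in>U. \<phi> x * u x"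
  have "L (\<lambda>y. \<phi> y * (inverse (\<phi> y) * ?v y)) x = L ?v x"
    by (rule local_onD[OF assms(1) _ assms(3)]) (simp add: assms(2))
  moreover have "L (\<lambda>y. inverse (\<phi> y) * ?v y) x = L u x"
    by (rule local_onD[OF assms(1) _ assms(3)]) (simp add: assms(2))
  ultimately show ?thesis
    by (simp add: A_hat_def B_op_def commutator_def)
qed

lemma bdd_above_times_phi:
  assumes "\<forall>x\<in>U. 0 < \<phi> x \<and> \<phi> x \<le> 1" and "phi_growth U \<phi> u"
  shows "bdd_above ((\<lambda>x\<in>U. \<phi> x * u x) ` U)"
proof -
  obtain C where C: "\<forall>x\<in>U. u x \<le> C * (1 + inverse (\<phi> x))"
    using assms(2) unfolding phi_growth_def by blast
  have "\<phi> x * u x \<le> 2 * \<bar>C\<bar>" if "x \<in> U" for x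
  proof -
    have pos: "0 < \<phi> x" and le1: "\<phi> x \<le> 1"
      using assms(1) that by auto
    have "\<phi> x * u x \<le> \<phi> x * (C * (1 + inverse (\<phi> x)))"
      using C that pos by (intro mult_left_mono) auto
    also have "\<dots> = C * (\<phi> x + 1)"
      using pos by (simp add: field_simps)
    also have "\<dots> \<le> \<bar>C\<bar> * 2"
      using pos le1 by (intro mult_mono) auto
    finally show ?thesis by simp
  qed
  then show ?thesis
    by (intro bdd_aboveI[where M = "2 * \<bar>C\<bar>"]) auto
qed

text \<open>
  The envelope of \<open>\<phi> u\<close> need not lie below that of \<open>u\<close>, because multiplication by \<open>\<phi> \<le> 1\<close> can raise
  negative values; what survives is \<open>\<phi> u \<le> max 0 u\<close>, which is enough for a comparison with \<open>0\<close>.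
\<close>

lemma usc_envelope_times_phi_nonpos:
  assumes phi: "\<forall>x\<in>U. 0 < \<phi> x \<and> \<phi> x \<le> 1" and "usc_envelope U u x \<le> 0"
  shows "usc_envelope U (\<lambda>x\<in>U. \<phi> x * u x) x \<le> 0"
proof (rule dense_ge)
  fix e :: ereal
  assume "0 < e"
  with assms(2) have "usc_envelope U u x < e" by order
  then obtain r where "r > 0" and r: "(SUP y\<in>ball x r \<inter> U. ereal (u y)) < e"
    unfolding usc_envelope_def INF_less_iff by auto
  have "ereal (\<phi> y * u y) \<le> e" if y: "y \<in> ball x r \<inter> U" for y
  proof (cases "u y \<le> 0")
    case True
    with phi y have "\<phi> y * u y \<le> 0" by (auto intro!: mult_nonneg_nonpos intro: less_imp_le)
    then have "ereal (\<phi> y * u y) \<le> 0" by simp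
    with \<open>0 < e\<close> show ?thesis by order
  next
    case False
    with phi y have "\<phi> y * u y \<le> u y" by (simp add: mult_left_le_one_le)
    moreover have "ereal (u y) < e"
      using r SUP_upper[OF y, of "\<lambda>y. ereal (u y)"] by order
    ultimately show ?thesis
      by (meson ereal_less_eq(3) le_less_trans less_imp_le)
  qed
  then have "(SUP y\<in>ball x r \<inter> U. ereal ((\<lambda>x\<in>U. \<phi> x * u x) y)) \<le> e"
    by (intro SUP_least) auto
  with \<open>r > 0\<close> show "usc_envelope U (\<lambda>x\<in>U. \<phi> x * u x) x \<le> e"
    unfolding usc_envelope_def by (intro INF_lower2[of r]) auto
qed

lemma times_phi_nonpos_iff:
  fixes \<phi> u :: "'x \<Rightarrow> real"
  assumes "\<forall>x\<in>U. 0 < \<phi> x \<and> \<phi> x \<le> 1" and "x \<in> U"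
  shows "\<phi> x * u x \<le> 0 \<longleftrightarrow> u x \<le> 0"
  using assms by (auto simp: mult_le_0_iff dest: bspec)

lemma wmp_classical_transfer:
  assumes loc: "local_on U L" and phi: "\<forall>x\<in>U. 0 < \<phi> x \<and> \<phi> x \<le> 1"
    and phi_mult: "\<forall>u\<in>K. phi_growth U \<phi> u \<longrightarrow> (\<lambda>x\<in>U. \<phi> x * u x) \<in> K"
    and wmp: "wmp_classical U \<Sigma> (A_hat L \<phi>) {u \<in> K. bdd_above (u ` U)}"
  shows "wmp_classical U \<Sigma> L {u \<in> K. phi_growth U \<phi> u}"
  unfolding wmp_classical_def
proof (intro ballI impI)
  fix u x
  assume u: "u \<in> {u \<in> K. phi_growth U \<phi> u}" and sub: "\<forall>x\<in>U. L u x \<le> 0"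
    and bdry: "\<forall>x\<in>frontier U - closure \<Sigma>. usc_envelope U u x \<le> 0" and x: "x \<in> U"
  let ?v = "\<lambda>x\<in>U. \<phi> x * u x"
  have "?v \<in> {u \<in> K. bdd_above (u ` U)}"
    using u phi_mult by (intro CollectI conjI bdd_above_times_phi[OF phi]) auto
  moreover have "A_hat L \<phi> ?v y \<le> 0" if "y \<in> U" for y
  proof -
    have "A_hat L \<phi> ?v y = \<phi> y * L u y"
      using phi by (intro A_hat_times_phi[OF loc _ that]) auto
    then show ?thesis
      using sub that times_phi_nonpos_iff[OF phi that] by simp
  qed
  moreover have "\<forall>x\<in>frontier U - closure \<Sigma>. usc_envelope U ?v x \<le> 0"
    using bdry usc_envelope_times_phi_nonpos[OF phi] by blast
  ultimately have "?v x \<le> 0"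
    using wmp x unfolding wmp_classical_def by blast
  then show "u x \<le> 0"
    using x times_phi_nonpos_iff[OF phi x] by simp
qed

lemma wmp_weak_transfer:
  assumes loc: "local_on U L" and phi: "\<forall>x\<in>U. 0 < \<phi> x \<and> \<phi> x \<le> 1"
    and phi_mult: "\<forall>u\<in>K. phi_growth U \<phi> u \<longrightarrow> (\<lambda>x\<in>U. \<phi> x * u x) \<in> K"
    and wmp: "wmp_weak U \<Sigma> (A_hat L \<phi>) {u \<in> K. bdd_above (u ` U)}"
  shows "wmp_weak U \<Sigma> L {u \<in> K. phi_growth U \<phi> u}"
  unfolding wmp_weak_def
proof (intro ballI impI)
  fix u x
  assume u: "u \<in> {u \<in> K. phi_growth U \<phi> u}" and sub: "AE x in lebesgue_on U. L u x \<le> 0"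
    and bdry: "\<forall>x\<in>frontier U - closure \<Sigma>. usc_envelope U u x \<le> 0" and x: "x \<in> U"
  let ?v = "\<lambda>x\<in>U. \<phi> x * u x"
  have "?v \<in> {u \<in> K. bdd_above (u ` U)}"
    using u phi_mult by (intro CollectI conjI bdd_above_times_phi[OF phi]) auto
  moreover have "AE y in lebesgue_on U. A_hat L \<phi> ?v y \<le> 0"
    using sub
  proof (rule AE_mp, intro AE_I2 impI)
    fix y assume "y \<in> space (lebesgue_on U)" and le: "L u y \<le> 0"
    then have y: "y \<in> U" by simp
    have "A_hat L \<phi> ?v y = \<phi> y * L u y"
      using phi by (intro A_hat_times_phi[OF loc _ y]) auto
    then show "A_hat L \<phi> ?v y \<le> 0"
      using le times_phi_nonpos_iff[OF phi y] by simp
  qed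
  moreover have "\<forall>x\<in>frontier U - closure \<Sigma>. usc_envelope U ?v x \<le> 0"
    using bdry usc_envelope_times_phi_nonpos[OF phi] by blast
  ultimately have "?v x \<le> 0"
    using wmp x unfolding wmp_weak_def by blast
  then show "u x \<le> 0"
    using x times_phi_nonpos_iff[OF phi x] by simp
qed

theorem theorem2p3:
  fixes U \<Sigma> :: "(real^'n::finite) set"
    and \<phi> :: "real^'n \<Rightarrow> real"
    and a :: "real^'n \<Rightarrow> real^'n^'n"
    and b :: "real^'n \<Rightarrow> real^'n"
    and c :: "real^'n \<Rightarrow> real"
    and K :: "(real^'n \<Rightarrow> real) set"
  assumes "open U"
    and "\<phi> \<in> C2 U" and "\<forall>x\<in>U. 0 < \<phi> x \<and> \<phi> x \<le> 1"
    and "\<forall>x\<in>U. nonneg_symmetric (a x)"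
    and "openin (top_of_set (frontier U)) \<Sigma>"
    and "convex_cone_on U K"
    and phi_mult: "\<forall>u\<in>K. phi_growth U \<phi> u \<longrightarrow> (\<lambda>x\<in>U. \<phi> x * u x) \<in> K"
  shows "(K \<subseteq> C2 U \<longrightarrow>
            wmp_classical U \<Sigma> (A_hat (A_classical a b c) \<phi>) {u \<in> K. bdd_above (u ` U)} \<longrightarrow>
            wmp_classical U \<Sigma> (A_classical a b c) {u \<in> K. phi_growth U \<phi> u})
       \<and> (K \<subseteq> W2d_loc U \<longrightarrow>
            a \<in> borel_measurable (lebesgue_on U) \<longrightarrow>
            b \<in> borel_measurable (lebesgue_on U) \<longrightarrow>
            c \<in> borel_measurable (lebesgue_on U) \<longrightarrow>
            wmp_weak U \<Sigma> (A_hat (A_weak U a b c) \<phi>) {u \<in> K. bdd_above (u ` U)} \<longrightarrow>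
            wmp_weak U \<Sigma> (A_weak U a b c) {u \<in> K. phi_growth U \<phi> u})"
proof (intro conjI impI)
  assume "wmp_classical U \<Sigma> (A_hat (A_classical a b c) \<phi>) {u \<in> K. bdd_above (u ` U)}"
  then show "wmp_classical U \<Sigma> (A_classical a b c) {u \<in> K. phi_growth U \<phi> u}"
    by (rule wmp_classical_transfer[OF local_on_A_classical[OF \<open>open U\<close>] assms(3) phi_mult])
next
  assume "wmp_weak U \<Sigma> (A_hat (A_weak U a b c) \<phi>) {u \<in> K. bdd_above (u ` U)}"
  then show "wmp_weak U \<Sigma> (A_weak U a b c) {u \<in> K. phi_growth U \<phi> u}"
    by (rule wmp_weak_transfer[OF local_on_A_weak assms(3) phi_mult])
qed

end
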